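(* Let $\epsilon\in(0,1)$. (Construction.) Choose arbitrarily $u,v$ and $a$ such that $\epsilon^2\le a<u<v<1$. Let $q:[\epsilon^2,u]\to[0,a]$ be any strictly decreasing continuous function and $p:[v,1]\to[0,\epsilon]$ any strictly increasing continuous function satisfying: (i) $q(\epsilon^2)=a$, $q(a)=\epsilon^2$, $p(v)=q(u)=0$, $p(1)=\epsilon$; (ii) the equation $p(x)=\epsilon x$ has the unique solution $x=1$ on $[v,1]$. Define $$\varphi_0(x)=\begin{cases}q(x),& x\in[\epsilon^2,u],\\ 0,& x\in[u,v],\\ p(x),& x\in[v,1],\end{cases}$$ $$\varphi_1(x)=\begin{cases}q^{-1}(\epsilon\, p(x/\epsilon^2)),& x\in[\epsilon^2v,\epsilon^2],\\ h(x),& x\in[\epsilon^2u,\epsilon^2v],\\ p^{-1}(\epsilon\, q(x/\epsilon^2)),& x\in[\epsilon^4,\epsilon^2u],\end{cases}\qquad(\mathrm A)$$ where $h$ is any continuous function on $[\epsilon^2u,\epsilon^2v]$ satisfying $h(\epsilon^2v)=u$ and $h(\epsilon^2u)=v$. For $k\ge2$ define $$\varphi_k(x)=p^{-1}(\epsilon\,\varphi_{k-1}(x/\epsilon^2)),\quad x\in[\epsilon^{2k+2},\epsilon^{2k}],\qquad(\mathrm B)$$ and let $\varphi(0)=1$ and $\varphi(x)=\varphi_k(x)$ for $x\in[\epsilon^{2k+2},\epsilon^{2k}]$, $k=0,1,2,\dots$. Then $\varphi$ is a single-valley-extended solution with platforms of the second type of FKS equation. (Converse.) Conversely, let $f$ be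 a single-valley-extended solution with platforms of the second type of FKS equation, let $[u,v]$ be the interval consisting of all minimum points of $f$, and suppose $\epsilon^2\le f(\epsilon^2)<u$. If $\varphi_k$ is the restriction of $f$ to $[\epsilon^{2k+2},\epsilon^{2k}]$ for $k=0,1,2,\dots$, then, with $a=f(\epsilon^2)$ and with $q,p,h$ the restrictions of $f$ to $[\epsilon^2,u]$, $[v,1]$, $[\epsilon^2u,\epsilon^2v]$ respectively, (i) and (ii) hold, (A) holds with $h$ continuous satisfying $h(\epsilon^2v)=u$ and $h(\epsilon^2u)=v$, and (B) holds for all $k\ge2$.
   Context: Fix $\epsilon\in(0,1)$. The second type of FKS equation, for an unknown function $f:[0,1]\to[0,1]$, is $$f(f(\epsilon^2x))=\epsilon f(x)\ \text{ for all } x\in[0,1],\qquad f(0)=1.$$ A function $f$ on an interval $[c,d]$ is a single-valley function with a platform if there is a subinterval $[u,v]\subset[c,d]$ such that $f$ is strictly decreasing on $[c,u]$, constant on $[u,v]$, and strictly increasing on $[v,d]$ (with $u<v$). A single-valley-extended solution with platforms is a continuous solution $f:[0,1]\to[0,1]$ of the equation whose restriction to $[\epsilon^2,1]$ is a single-valley function with a platform. A minimum point of $f$ is a point of $[0,1]$ at which $f$ attains its minimum over $[0,1]$.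
   Formalization: In the construction, h is additionally required to take values in [u,v]; for an arbitrary continuous h with the given end values the claim fails, since for x in [u,v] the equation forces φ(h(ε²x))=0, hence h(ε²x) in [u,v]. *)

theory Defs
  imports Complex_Main "HOL-Library.FuncSet"
begin

definition fks2_solution :: "real \<Rightarrow> (real \<Rightarrow> real) \<Rightarrow> bool" where
  "fks2_solution \<epsilon> f \<longleftrightarrow>
     f \<in> {0..1} \<rightarrow> {0..1} \<and>
     (\<forall>x\<in>{0..1}. f (f (\<epsilon>\<^sup>2 * x)) = \<epsilon> * f x) \<and> f 0 = 1"

definition single_valley_platform :: "real \<Rightarrow> real \<Rightarrow> (real \<Rightarrow> real) \<Rightarrow> bool" where
  "single_valley_platform c d f \<longleftrightarrow>
     (\<exists>u v. c \<le> u \<and> u < v \<and> v \<le> d \<and>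
        strict_antimono_on {c..u} f \<and>
        (\<forall>x\<in>{u..v}. \<forall>y\<in>{u..v}. f x = f y) \<and>
        strict_mono_on {v..d} f)"

definition svep_solution :: "real \<Rightarrow> (real \<Rightarrow> real) \<Rightarrow> bool" where
  "svep_solution \<epsilon> f \<longleftrightarrow>
     fks2_solution \<epsilon> f \<and> continuous_on {0..1} f \<and> single_valley_platform (\<epsilon>\<^sup>2) 1 f"

definition minimum_points :: "(real \<Rightarrow> real) \<Rightarrow> real set" where
  "minimum_points f = {x \<in> {0..1}. \<forall>y\<in>{0..1}. f x \<le> f y}"

definition level :: "real \<Rightarrow> nat \<Rightarrow> real set" where
  "level \<epsilon> k = {\<epsilon> ^ (2 * k + 2)..\<epsilon> ^ (2 * k)}"

definition cond_i :: "real \<Rightarrow> real \<Rightarrow> real \<Rightarrow> real \<Rightarrow> (real \<Rightarrow> real) \<Rightarrow> (real \<Rightarrow> real) \<Rightarrow> bool" where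
  "cond_i \<epsilon> u v a q p \<longleftrightarrow>
     q (\<epsilon>\<^sup>2) = a \<and> q a = \<epsilon>\<^sup>2 \<and> p v = 0 \<and> q u = 0 \<and> p 1 = \<epsilon>"

definition cond_ii :: "real \<Rightarrow> real \<Rightarrow> (real \<Rightarrow> real) \<Rightarrow> bool" where
  "cond_ii \<epsilon> v p \<longleftrightarrow> (\<forall>x\<in>{v..1}. p x = \<epsilon> * x \<longleftrightarrow> x = 1)"

text \<open>The codomain $[u,v]$ of $h$ cannot be dropped: at a point $x$ of $[u,v]$ the equation says that
  the value of $h$ at $\epsilon^2 x$ is a zero of the solution, and the zeros are exactly the points
  of $[u,v]$.\<close>

definition admissible_data ::
  "real \<Rightarrow> real \<Rightarrow> real \<Rightarrow> real \<Rightarrow> (real \<Rightarrow> real) \<Rightarrow> (real \<Rightarrow> real) \<Rightarrow> (real \<Rightarrow> real) \<Rightarrow> bool" where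
  "admissible_data \<epsilon> u v a q p h \<longleftrightarrow>
     \<epsilon>\<^sup>2 \<le> a \<and> a < u \<and> u < v \<and> v < 1 \<and>
     q \<in> {\<epsilon>\<^sup>2..u} \<rightarrow> {0..a} \<and> strict_antimono_on {\<epsilon>\<^sup>2..u} q \<and> continuous_on {\<epsilon>\<^sup>2..u} q \<and>
     p \<in> {v..1} \<rightarrow> {0..\<epsilon>} \<and> strict_mono_on {v..1} p \<and> continuous_on {v..1} p \<and>
     cond_i \<epsilon> u v a q p \<and> cond_ii \<epsilon> v p \<and>
     h \<in> {\<epsilon>\<^sup>2 * u..\<epsilon>\<^sup>2 * v} \<rightarrow> {u..v} \<and> continuous_on {\<epsilon>\<^sup>2 * u..\<epsilon>\<^sup>2 * v} h \<and>
     h (\<epsilon>\<^sup>2 * v) = u \<and> h (\<epsilon>\<^sup>2 * u) = v"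

text \<open>The piecewise definitions are equations on the closed pieces, so that they also assert
  agreement at common endpoints.\<close>

definition eq_phi0 ::
  "real \<Rightarrow> real \<Rightarrow> real \<Rightarrow> (real \<Rightarrow> real) \<Rightarrow> (real \<Rightarrow> real) \<Rightarrow> (real \<Rightarrow> real) \<Rightarrow> bool" where
  "eq_phi0 \<epsilon> u v q p \<phi>\<^sub>0 \<longleftrightarrow>
     (\<forall>x\<in>{\<epsilon>\<^sup>2..u}. \<phi>\<^sub>0 x = q x) \<and>
     (\<forall>x\<in>{u..v}. \<phi>\<^sub>0 x = 0) \<and>
     (\<forall>x\<in>{v..1}. \<phi>\<^sub>0 x = p x)"

definition eq_A ::
  "real \<Rightarrow> real \<Rightarrow> real \<Rightarrow> (real \<Rightarrow> real) \<Rightarrow> (real \<Rightarrow> real) \<Rightarrow> (real \<Rightarrow> real) \<Rightarrow> (real \<Rightarrow> real) \<Rightarrow> bool" where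
  "eq_A \<epsilon> u v q p h \<phi>\<^sub>1 \<longleftrightarrow>
     (\<forall>x\<in>{\<epsilon>\<^sup>2 * v..\<epsilon>\<^sup>2}. \<phi>\<^sub>1 x = inv_into {\<epsilon>\<^sup>2..u} q (\<epsilon> * p (x / \<epsilon>\<^sup>2))) \<and>
     (\<forall>x\<in>{\<epsilon>\<^sup>2 * u..\<epsilon>\<^sup>2 * v}. \<phi>\<^sub>1 x = h x) \<and>
     (\<forall>x\<in>{\<epsilon> ^ 4..\<epsilon>\<^sup>2 * u}. \<phi>\<^sub>1 x = inv_into {v..1} p (\<epsilon> * q (x / \<epsilon>\<^sup>2)))"

definition eq_B :: "real \<Rightarrow> real \<Rightarrow> (real \<Rightarrow> real) \<Rightarrow> (nat \<Rightarrow> real \<Rightarrow> real) \<Rightarrow> bool" where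
  "eq_B \<epsilon> v p \<Phi> \<longleftrightarrow>
     (\<forall>k\<ge>2. \<forall>x\<in>level \<epsilon> k. \<Phi> k x = inv_into {v..1} p (\<epsilon> * \<Phi> (k - 1) (x / \<epsilon>\<^sup>2)))"

definition pieces ::
  "real \<Rightarrow> real \<Rightarrow> real \<Rightarrow> (real \<Rightarrow> real) \<Rightarrow> (real \<Rightarrow> real) \<Rightarrow> (real \<Rightarrow> real) \<Rightarrow> (nat \<Rightarrow> real \<Rightarrow> real) \<Rightarrow> bool" where
  "pieces \<epsilon> u v q p h \<Phi> \<longleftrightarrow>
     eq_phi0 \<epsilon> u v q p (\<Phi> 0) \<and> eq_A \<epsilon> u v q p h (\<Phi> 1) \<and> eq_B \<epsilon> v p \<Phi>"

definition glues :: "real \<Rightarrow> (nat \<Rightarrow> real \<Rightarrow> real) \<Rightarrow> (real \<Rightarrow> real) \<Rightarrow> bool" where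
  "glues \<epsilon> \<Phi> \<phi> \<longleftrightarrow> \<phi> 0 = 1 \<and> (\<forall>k. \<forall>x\<in>level \<epsilon> k. \<phi> x = \<Phi> k x)"

end

theory Submission
  imports Defs
begin

text \<open>Everything is driven by the equation read as \<open>\<phi> (\<epsilon>\<^sup>2 x) = g (\<phi> x)\<close> for \<open>x \<le> u\<close>, where
  \<open>g y = p\<^sup>-\<^sup>1 (\<epsilon> y)\<close>. The map \<open>g\<close> is increasing, and by condition (ii) its only fixed point is \<open>1\<close>, so
  its iterates from \<open>0\<close> tend to \<open>1\<close> and bound \<open>\<phi>\<close> from below on the intervals \<open>[0, \<epsilon>\<^bsup>2n\<^esup> u]\<close>; this gives
  continuity at \<open>0\<close>.

  Conversely, the equation makes the minimum value of a solution \<open>0\<close> and shows that, for \<open>x\<close> in \<open>[0, 1]\<close>,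
  \<open>f (\<epsilon>\<^sup>2 x)\<close> lies in \<open>[u, v]\<close> exactly when \<open>x\<close> does. The intermediate value theorem then places
  \<open>f (\<epsilon>\<^sup>2 x)\<close> in the branch \<open>[v, 1]\<close> for \<open>x \<le> u\<close> and in the branch \<open>[\<epsilon>\<^sup>2, u]\<close> for \<open>x \<ge> v\<close>, on which \<open>f\<close> can be
  inverted.\<close>

section \<open>Geometric levels and their shift under multiplication by
  \<open>\<epsilon>\<^sup>2\<close>\<close>

lemma level_eq_power: "level \<epsilon> k = {(\<epsilon>\<^sup>2) ^ Suc k..(\<epsilon>\<^sup>2) ^ k}"
  by (simp add: level_def power_mult[symmetric] power_add[symmetric] power2_eq_square[symmetric] algebra_simps)

locale contraction_ratio =
  fixes \<epsilon> :: real
  assumes eps_pos: "0 < \<epsilon>" and eps_less_1: "\<epsilon> < 1"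
begin

lemma eps2: "0 < \<epsilon>\<^sup>2" "\<epsilon>\<^sup>2 < \<epsilon>" "\<epsilon>\<^sup>2 < 1"
  using eps_pos eps_less_1 by (simp_all add: power2_eq_square mult_less_cancel_left2 mult_strict_mono[of \<epsilon> 1 \<epsilon> 1, simplified])

lemma eps2_power_less: "0 < x \<Longrightarrow> \<exists>n. (\<epsilon>\<^sup>2) ^ n < x"
  using real_arch_pow_inv eps2 by blast

lemma scaled_mem_level_iff: "\<epsilon>\<^sup>2 * x \<in> level \<epsilon> (Suc k) \<longleftrightarrow> x \<in> level \<epsilon> k"
  using mult_le_cancel_left_pos[OF eps2(1), of "(\<epsilon>\<^sup>2) ^ Suc k" x]
    mult_le_cancel_left_pos[OF eps2(1), of x "(\<epsilon>\<^sup>2) ^ k"]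
  by (simp only: level_eq_power atLeastAtMost_iff power_Suc)

lemma mem_level_SucE:
  assumes "x \<in> level \<epsilon> (Suc k)"
  obtains y where "y \<in> level \<epsilon> k" "x = \<epsilon>\<^sup>2 * y"
proof
  show "x = \<epsilon>\<^sup>2 * (x / \<epsilon>\<^sup>2)" using eps2 by simp
  then show "x / \<epsilon>\<^sup>2 \<in> level \<epsilon> k" using assms scaled_mem_level_iff by metis
qed

text \<open>The least \<open>n\<close> with \<open>(\<epsilon>\<^sup>2) ^ n < x\<close> is positive
  because \<open>x\<close> is at most 1; its predecessor is the level.\<close>

lemma mem_level_exists:
  assumes "0 < x" "x \<le> 1"
  shows "\<exists>k. x \<in> level \<epsilon> k"
proof -
  define n where "n = (LEAST n. (\<epsilon>\<^sup>2) ^ n < x)"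
  have n: "(\<epsilon>\<^sup>2) ^ n < x"
    unfolding n_def using eps2_power_less[OF assms(1)] by (rule LeastI_ex)
  with assms obtain k where k: "n = Suc k" by (cases n) auto
  then have "\<not> (\<epsilon>\<^sup>2) ^ k < x"
    using not_less_Least[of k "\<lambda>n. (\<epsilon>\<^sup>2) ^ n < x"] by (simp add: n_def)
  with n k have "x \<in> level \<epsilon> k" by (auto simp: level_eq_power)
  then show ?thesis ..
qed

text \<open>Only consecutive levels touch, in a single point, so gluing needs agreement at these
  points alone.\<close>

lemma levels_meet:
  assumes "x \<in> level \<epsilon> j" "x \<in> level \<epsilon> k" "j < k"
  shows "k = Suc j" "x = (\<epsilon>\<^sup>2) ^ k"
proof -
  have *: "(\<epsilon>\<^sup>2) ^ Suc j \<le> x" "x \<le> (\<epsilon>\<^sup>2) ^ k" using assms by (auto simp: level_eq_power)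
  then have "(\<epsilon>\<^sup>2) ^ Suc j \<le> (\<epsilon>\<^sup>2) ^ k" by linarith
  then have "k \<le> Suc j"
    using eps2 by (meson not_le_imp_less not_less power_strict_decreasing)
  then show "k = Suc j" using assms by simp
  then show "x = (\<epsilon>\<^sup>2) ^ k" using * by auto
qed

lemma mem_level_le: "x \<in> level \<epsilon> k \<Longrightarrow> 0 < x \<and> x \<le> 1"
  using eps2 by (auto simp: level_eq_power intro: order_trans[OF _ power_le_one] less_le_trans[rotated])

lemma mem_level_Suc_le:
  assumes "x \<in> level \<epsilon> (Suc k)"
  shows "x \<le> \<epsilon>\<^sup>2"
proof -
  obtain y where "y \<in> level \<epsilon> k" "x = \<epsilon>\<^sup>2 * y" using assms by (rule mem_level_SucE)
  with mem_level_le[of y k] eps2 show ?thesis by simp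
qed

end

section \<open>The branches \<open>q\<close> and \<open>p\<close>, their inverses, and the iteration
  of \<open>lift\<close>\<close>

locale platform_data = contraction_ratio +
  fixes u v a :: real and q p h :: "real \<Rightarrow> real"
  assumes admissible: "admissible_data \<epsilon> u v a q p h"
begin

abbreviation "qinv \<equiv> inv_into {\<epsilon>\<^sup>2..u} q"
abbreviation "pinv \<equiv> inv_into {v..1} p"

lemma order: "\<epsilon>\<^sup>2 \<le> a" "a < u" "u < v" "v < 1" "\<epsilon>\<^sup>2 < u" "0 < u" "0 < v"
proof -
  show "\<epsilon>\<^sup>2 \<le> a" "a < u" "u < v" "v < 1" using admissible by (auto simp: admissible_data_def)
  then show "\<epsilon>\<^sup>2 < u" "0 < u" "0 < v" using eps2(1) by linarith+
qed

lemma end_values: "q (\<epsilon>\<^sup>2) = a" "q a = \<epsilon>\<^sup>2" "p v = 0" "q u = 0" "p 1 = \<epsilon>"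
    "h (\<epsilon>\<^sup>2 * v) = u" "h (\<epsilon>\<^sup>2 * u) = v"
  using admissible by (auto simp: admissible_data_def cond_i_def)

lemma ranges:
  "x \<in> {\<epsilon>\<^sup>2..u} \<Longrightarrow> q x \<in> {0..a}" "x \<in> {v..1} \<Longrightarrow> p x \<in> {0..\<epsilon>}"
  "x \<in> {\<epsilon>\<^sup>2 * u..\<epsilon>\<^sup>2 * v} \<Longrightarrow> h x \<in> {u..v}"
  using admissible unfolding admissible_data_def by (blast dest: funcset_mem)+

lemma strict_monos: "strict_antimono_on {\<epsilon>\<^sup>2..u} q" "strict_mono_on {v..1} p"
  using admissible by (auto simp: admissible_data_def)

lemma conts: "continuous_on {\<epsilon>\<^sup>2..u} q" "continuous_on {v..1} p"
    "continuous_on {\<epsilon>\<^sup>2 * u..\<epsilon>\<^sup>2 * v} h"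
  using admissible by (auto simp: admissible_data_def)

lemma inj_q: "inj_on q {\<epsilon>\<^sup>2..u}"
proof (rule inj_onI)
  fix x y assume "x \<in> {\<epsilon>\<^sup>2..u}" "y \<in> {\<epsilon>\<^sup>2..u}" "q x = q y"
  then show "x = y"
    using monotone_onD[OF strict_monos(1), of x y] monotone_onD[OF strict_monos(1), of y x]
    by (metis less_irrefl linorder_neqE)
qed

lemma inj_p: "inj_on p {v..1}"
  using strict_monos(2) by (rule strict_mono_on_imp_inj_on)

text \<open>The end values and the intermediate value theorem give surjectivity, so that
  \<open>qinv\<close> is a true inverse on all of \<open>{0..a}\<close>.\<close>

lemma image_q: "q ` {\<epsilon>\<^sup>2..u} = {0..a}"
proof
  show "{0..a} \<subseteq> q ` {\<epsilon>\<^sup>2..u}"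
  proof
    fix y assume "y \<in> {0..a}"
    then obtain x where "\<epsilon>\<^sup>2 \<le> x" "x \<le> u" "q x = y"
      using IVT2'[of q u y "\<epsilon>\<^sup>2"] end_values order conts by auto
    then show "y \<in> q ` {\<epsilon>\<^sup>2..u}" by force
  qed
qed (use ranges in blast)

lemma image_p: "p ` {v..1} = {0..\<epsilon>}"
proof
  show "{0..\<epsilon>} \<subseteq> p ` {v..1}"
  proof
    fix y assume "y \<in> {0..\<epsilon>}"
    then obtain x where "v \<le> x" "x \<le> 1" "p x = y"
      using IVT'[of p v y 1] end_values order conts by auto
    then show "y \<in> p ` {v..1}" by force
  qed
qed (use ranges in blast)

lemma qinv:
  assumes "y \<in> {0..a}"
  shows "qinv y \<in> {\<epsilon>\<^sup>2..u}" "q (qinv y) = y"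
  using assms inv_into_into[of y q "{\<epsilon>\<^sup>2..u}"] f_inv_into_f[of y q "{\<epsilon>\<^sup>2..u}"]
  unfolding image_q by blast+

lemma pinv:
  assumes "y \<in> {0..\<epsilon>}"
  shows "pinv y \<in> {v..1}" "p (pinv y) = y"
  using assms inv_into_into[of y p "{v..1}"] f_inv_into_f[of y p "{v..1}"]
  unfolding image_p by blast+

lemma cont_qinv: "continuous_on {0..a} qinv"
  using continuous_on_inv[OF conts(1) compact_Icc, of qinv] inj_q image_q by simp

lemma cont_pinv: "continuous_on {0..\<epsilon>} pinv"
  using continuous_on_inv[OF conts(2) compact_Icc, of pinv] inj_p image_p by simp

lemma qinv_values: "qinv 0 = u" "qinv (\<epsilon>\<^sup>2) = a"
  using inv_into_f_f[OF inj_q, of u] inv_into_f_f[OF inj_q, of a] end_values order by auto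

lemma pinv_values: "pinv 0 = v" "pinv \<epsilon> = 1"
  using inv_into_f_f[OF inj_p, of v] inv_into_f_f[OF inj_p, of 1] end_values order by auto

text \<open>This is the map \<open>g\<close> of the overview.\<close>

definition lift :: "real \<Rightarrow> real" where
  "lift y = pinv (\<epsilon> * y)"

lemma eps_mult_mem: "y \<in> {0..1} \<Longrightarrow> \<epsilon> * y \<in> {0..\<epsilon>}"
  using eps_pos by (auto simp: mult_le_cancel_left2)

lemma lift:
  assumes "y \<in> {0..1}"
  shows "lift y \<in> {v..1}" "p (lift y) = \<epsilon> * y" "lift y \<in> {0..1}"
proof -
  show *: "lift y \<in> {v..1}" "p (lift y) = \<epsilon> * y"
    using pinv[OF eps_mult_mem[OF assms]] by (auto simp: lift_def)
  show "lift y \<in> {0..1}" using * order by auto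
qed

text \<open>Were the order reversed, the strictly increasing \<open>p\<close> would also reverse the
  order of \<open>\<epsilon> * x\<close> and \<open>\<epsilon> * y\<close>.\<close>

lemma lift_mono:
  assumes "x \<in> {0..1}" "y \<in> {0..1}" "x \<le> y"
  shows "lift x \<le> lift y"
proof (rule ccontr)
  assume "\<not> ?thesis"
  then have "p (lift y) < p (lift x)"
    using strict_mono_onD[OF strict_monos(2), of "lift y" "lift x"] lift assms by auto
  then show False using lift assms eps_pos by simp
qed

lemma lift_1: "lift 1 = 1"
  by (simp add: lift_def pinv_values)

lemma cont_lift: "continuous_on {0..1} lift"
  unfolding lift_def
  by (rule continuous_on_compose2[OF cont_pinv]) (use eps_mult_mem in \<open>auto intro!: continuous_intros\<close>)

definition lower :: "nat \<Rightarrow> real" where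
  "lower n = (lift ^^ n) 0"

lemma lower_mem: "lower n \<in> {0..1}"
  by (induction n) (use lift(3) in \<open>auto simp: lower_def\<close>)

lemma lower_Suc: "lower (Suc n) = lift (lower n)"
  by (simp add: lower_def)

text \<open>The orbit starts at the least possible value 0, and monotonicity of \<open>lift\<close>
  propagates the first comparison.\<close>

lemma lower_mono: "lower n \<le> lower (Suc n)"
proof (induction n)
  case 0
  show ?case using lower_mem[of 1] by (simp add: lower_def)
next
  case (Suc n)
  then show ?case
    using lift_mono lower_mem by (metis lower_Suc)
qed

text \<open>The limit of the lower bounds solves \<open>p L = \<epsilon> L\<close>, so condition (ii) forces it to be \<open>1\<close>.\<close>

lemma lower_tendsto: "lower \<longlonglongrightarrow> 1"
proof -
  have "incseq lower" using lower_mono by (rule incseq_SucI)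
  moreover have "\<And>i. lower i \<le> 1" using lower_mem by simp
  ultimately obtain L where L: "lower \<longlonglongrightarrow> L"
    using incseq_convergent[of lower 1] by blast
  \<comment> \<open>The shift drops \<open>lower 0 = 0\<close>, which lies outside
    \<open>{v..1}\<close>, where continuity of \<open>p\<close> is known.\<close>
  have L1: "(\<lambda>n. lower (Suc n)) \<longlonglongrightarrow> L" using L by (rule LIMSEQ_Suc)
  have mem: "lower (Suc n) \<in> {v..1}" for n
    unfolding lower_Suc using lift(1) lower_mem by blast
  have "L \<in> {v..1}"
    using closed_sequentially[OF closed_atLeastAtMost mem L1] .
  have "(\<lambda>n. p (lower (Suc n))) \<longlonglongrightarrow> p L"
    using continuous_on_tendsto_compose[OF conts(2) L1 \<open>L \<in> _\<close>] mem by simp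
  moreover have "(\<lambda>n. p (lower (Suc n))) = (\<lambda>n. \<epsilon> * lower n)"
    using lift(2)[OF lower_mem] by (simp add: lower_Suc)
  moreover have "(\<lambda>n. \<epsilon> * lower n) \<longlonglongrightarrow> \<epsilon> * L"
    using L by (rule tendsto_mult_left)
  ultimately have "p L = \<epsilon> * L"
    using LIMSEQ_unique by metis
  then have "L = 1"
    using admissible \<open>L \<in> _\<close> by (simp add: admissible_data_def cond_ii_def)
  with L show ?thesis by simp
qed

end

section \<open>Every glued function is a solution\<close>

locale platform_glued = platform_data +
  fixes \<Phi> :: "nat \<Rightarrow> real \<Rightarrow> real" and \<phi> :: "real \<Rightarrow> real"
  assumes pieces: "pieces \<epsilon> u v q p h \<Phi>" and glues: "glues \<epsilon> \<Phi> \<phi>"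
begin

lemma phi_0: "\<phi> 0 = 1"
  using glues by (simp add: glues_def)

lemma phi_level: "x \<in> level \<epsilon> k \<Longrightarrow> \<phi> x = \<Phi> k x"
  using glues by (simp add: glues_def)

lemma phi_top:
  "x \<in> {\<epsilon>\<^sup>2..u} \<Longrightarrow> \<phi> x = q x" "x \<in> {u..v} \<Longrightarrow> \<phi> x = 0" "x \<in> {v..1} \<Longrightarrow> \<phi> x = p x"
  using pieces phi_level[of x 0] order by (auto simp: pieces_def eq_phi0_def level_eq_power)

lemma top_range:
  assumes "x \<in> {\<epsilon>\<^sup>2..1}"
  shows "\<phi> x \<in> {0..1}"
proof -
  consider "x \<in> {\<epsilon>\<^sup>2..u}" | "x \<in> {u..v}" | "x \<in> {v..1}" using assms by fastforce
  then show ?thesis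
  proof cases
    case 1
    then show ?thesis using phi_top(1)[of x] ranges(1)[of x] order by simp
  next
    case 2
    then show ?thesis using phi_top(2)[of x] by simp
  next
    case 3
    then show ?thesis using phi_top(3)[of x] ranges(2)[of x] eps_less_1 by simp
  qed
qed

lemma level_1: "x \<in> {\<epsilon>\<^sup>2..1} \<Longrightarrow> \<epsilon>\<^sup>2 * x \<in> level \<epsilon> 1"
  using scaled_mem_level_iff[of x 0] by (simp add: level_eq_power)

lemma phi_scaled_high:
  assumes "x \<in> {v..1}"
  shows "\<phi> (\<epsilon>\<^sup>2 * x) = qinv (\<epsilon> * \<phi> x)"
  using pieces phi_level[OF level_1, of x] phi_top(3)[of x] order eps2 assms
  by (auto simp: pieces_def eq_A_def)

lemma phi_scaled_mid:
  assumes "x \<in> {u..v}"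
  shows "\<phi> (\<epsilon>\<^sup>2 * x) = h (\<epsilon>\<^sup>2 * x)"
  using pieces phi_level[OF level_1, of x] order eps2 assms
  by (auto simp: pieces_def eq_A_def)

text \<open>One rule covers three sources: at 0 the value 1 is fixed by \<open>lift\<close>, on
  level 0 the last clause of \<open>eq_A\<close> applies, and on later levels \<open>eq_B\<close>
  does.\<close>

lemma phi_scaled_low:
  assumes "x \<in> {0..u}"
  shows "\<phi> (\<epsilon>\<^sup>2 * x) = lift (\<phi> x)"
proof (cases "x = 0")
  case True
  then show ?thesis by (simp add: phi_0 lift_1)
next
  case False
  then obtain k where k: "x \<in> level \<epsilon> k"
    using mem_level_exists[of x] assms order by auto
  then have k1: "\<epsilon>\<^sup>2 * x \<in> level \<epsilon> (Suc k)" by (simp add: scaled_mem_level_iff)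
  show ?thesis
  proof (cases k)
    case 0
    then have "x \<in> {\<epsilon>\<^sup>2..u}" using k assms by (simp add: level_eq_power)
    moreover from this have "\<epsilon>\<^sup>2 * x \<in> {\<epsilon> ^ 4..\<epsilon>\<^sup>2 * u}"
      using eps2(1) mult_left_mono[of "\<epsilon>\<^sup>2" x "\<epsilon>\<^sup>2"] by (simp add: power_add[symmetric])
    ultimately show ?thesis
      using pieces phi_level[OF k1] 0 phi_top(1)[of x] eps2
      by (auto simp: pieces_def eq_A_def lift_def simp del: atLeastAtMost_iff)
  next
    case (Suc j)
    then show ?thesis
      using pieces phi_level[OF k1] phi_level[OF k] k1 eps2
      by (auto simp: pieces_def eq_B_def lift_def)
  qed
qed

text \<open>Places the argument of \<open>qinv\<close> in its domain: \<open>p\<close> is at most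
  \<epsilon>, and \<open>\<epsilon>\<^sup>2 \<le> a\<close>.\<close>

lemma eps_phi_high:
  assumes "x \<in> {v..1}"
  shows "\<epsilon> * \<phi> x \<in> {0..a}"
proof -
  have \<phi>: "0 \<le> \<phi> x" "\<phi> x \<le> \<epsilon>"
    using phi_top(3)[OF assms] ranges(2)[OF assms] by simp_all
  then have "\<epsilon> * \<phi> x \<le> \<epsilon>\<^sup>2"
    using eps_pos unfolding power2_eq_square by (intro mult_left_mono) simp_all
  then show ?thesis using \<phi> order(1) eps_pos by simp
qed

text \<open>Induction on the level: the three scaling rules carry the bound from one level to the
  next.\<close>

lemma phi_range:
  assumes "x \<in> {0..1}"
  shows "\<phi> x \<in> {0..1}"
proof (cases "x = 0")
  case True
  then show ?thesis by (simp add: phi_0)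
next
  case False
  have "y \<in> level \<epsilon> k \<Longrightarrow> \<phi> y \<in> {0..1}" for y k
  proof (induction k arbitrary: y)
    case 0
    then show ?case using top_range[of y] by (simp add: level_eq_power)
  next
    case (Suc k)
    obtain x where x: "x \<in> level \<epsilon> k" "y = \<epsilon>\<^sup>2 * x" using Suc.prems by (rule mem_level_SucE)
    then have IH: "\<phi> x \<in> {0..1}" using Suc.IH by blast
    have "0 < x" "x \<le> 1" using mem_level_le x by auto
    then consider "x \<in> {0..u}" | "x \<in> {u..v}" | "x \<in> {v..1}" by fastforce
    then show ?case
    proof cases
      case 1
      then show ?thesis using phi_scaled_low IH lift x by simp
    next
      case 2
      then have "\<phi> y \<in> {u..v}"
        using phi_scaled_mid[OF 2] ranges(3)[of y] x eps2 by simp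
      then show ?thesis using order by auto
    next
      case 3
      have "\<phi> y \<in> {\<epsilon>\<^sup>2..u}" using phi_scaled_high[OF 3] qinv(1)[OF eps_phi_high[OF 3]] x by simp
      then show ?thesis using order eps2(1) by (meson atLeastAtMost_iff less_imp_le order_trans)
    qed
  qed
  then show ?thesis using False assms mem_level_exists[of x] by auto
qed

text \<open>In the outer cases the inner value lands in the branch that was inverted, so the outer
  \<phi> cancels the inverse; on the platform both sides are 0.\<close>

lemma phi_equation:
  assumes "x \<in> {0..1}"
  shows "\<phi> (\<phi> (\<epsilon>\<^sup>2 * x)) = \<epsilon> * \<phi> x"
proof -
  consider "x \<in> {0..u}" | "x \<in> {u..v}" | "x \<in> {v..1}" using assms by fastforce
  then show ?thesis
  proof cases
    case 1
    then show ?thesis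
      using phi_scaled_low[OF 1] lift[OF phi_range[OF assms]] phi_top(3) by simp
  next
    case 2
    then have "h (\<epsilon>\<^sup>2 * x) \<in> {u..v}" using ranges(3) eps2 by simp
    then show ?thesis using phi_scaled_mid[OF 2] phi_top(2) 2 by simp
  next
    case 3
    then show ?thesis
      using phi_scaled_high[OF 3] qinv[OF eps_phi_high[OF 3]] phi_top(1) by simp
  qed
qed

lemma cont_top: "continuous_on {\<epsilon>\<^sup>2..1} \<phi>"
proof -
  have 1: "continuous_on {\<epsilon>\<^sup>2..u} \<phi>"
    using conts(1) continuous_on_cong[of _ _ \<phi> q] phi_top by blast
  have 2: "continuous_on {u..v} \<phi>"
    using continuous_on_const[of "{u..v}" 0] continuous_on_cong[of _ _ \<phi> "\<lambda>_. 0"] phi_top by blast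
  have 3: "continuous_on {v..1} \<phi>"
    using conts(2) continuous_on_cong[of _ _ \<phi> p] phi_top by blast
  have "{\<epsilon>\<^sup>2..u} \<union> {u..v} \<union> {v..1} = {\<epsilon>\<^sup>2..1}" using order by auto
  then show ?thesis
    using continuous_on_closed_Un[OF _ _ continuous_on_closed_Un[OF _ _ 1 2] 3] by (simp add: closed_Un)
qed

lemma cont_scaled:
  assumes "continuous_on {c..d} (\<lambda>x. \<phi> (\<epsilon>\<^sup>2 * x))"
  shows "continuous_on {\<epsilon>\<^sup>2 * c..\<epsilon>\<^sup>2 * d} \<phi>"
proof -
  have "continuous_on {\<epsilon>\<^sup>2 * c..\<epsilon>\<^sup>2 * d} (\<lambda>y. \<phi> (\<epsilon>\<^sup>2 * (y / \<epsilon>\<^sup>2)))"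
    by (rule continuous_on_compose2[OF assms])
      (use eps2 eps_pos in \<open>auto simp: field_simps intro!: continuous_intros\<close>)
  then show ?thesis using eps_pos by simp
qed

text \<open>Continuity on \<open>{b..1}\<close> passes through the three scaling rules to
  \<open>\<lambda>x. \<phi> (\<epsilon>\<^sup>2 * x)\<close>; rescaling yields the interval from
  \<open>\<epsilon>\<^sup>2 * b\<close> to \<open>\<epsilon>\<^sup>2\<close>, which is pasted to the
  top level.\<close>

lemma cont_away_from_0: "continuous_on {(\<epsilon>\<^sup>2) ^ Suc n..1} \<phi>"
proof (induction n)
  case 0
  show ?case using cont_top by simp
next
  case (Suc n)
  let ?b = "(\<epsilon>\<^sup>2) ^ Suc n"
  have b: "0 < ?b" "?b \<le> \<epsilon>\<^sup>2"
    using eps2 by (auto simp: power_le_one mult_le_cancel_left2)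
  have "continuous_on {?b..u} (\<lambda>x. lift (\<phi> x))"
    by (rule continuous_on_compose2[OF cont_lift continuous_on_subset[OF Suc]])
      (use b order phi_range in force)+
  then have 1: "continuous_on {?b..u} (\<lambda>x. \<phi> (\<epsilon>\<^sup>2 * x))"
    by (rule continuous_on_cong[THEN iffD2, rotated -1]) (use b phi_scaled_low in auto)
  have "continuous_on {u..v} (\<lambda>x. h (\<epsilon>\<^sup>2 * x))"
    by (rule continuous_on_compose2[OF conts(3)]) (use eps2 in \<open>auto intro!: continuous_intros\<close>)
  then have 2: "continuous_on {u..v} (\<lambda>x. \<phi> (\<epsilon>\<^sup>2 * x))"
    by (rule continuous_on_cong[THEN iffD2, rotated -1]) (use phi_scaled_mid in auto)
  have "continuous_on {v..1} \<phi>"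
    by (rule continuous_on_subset[OF cont_top]) (use order in auto)
  then have "continuous_on {v..1} (\<lambda>x. qinv (\<epsilon> * \<phi> x))"
    by (intro continuous_on_compose2[OF cont_qinv] continuous_intros) (use eps_phi_high in auto)
  then have 3: "continuous_on {v..1} (\<lambda>x. \<phi> (\<epsilon>\<^sup>2 * x))"
    by (rule continuous_on_cong[THEN iffD2, rotated -1]) (use phi_scaled_high in auto)
  have "{?b..u} \<union> {u..v} \<union> {v..1} = {?b..1}" using order b by auto
  then have "continuous_on {?b..1} (\<lambda>x. \<phi> (\<epsilon>\<^sup>2 * x))"
    using continuous_on_closed_Un[OF _ _ continuous_on_closed_Un[OF _ _ 1 2] 3] by (simp add: closed_Un)
  from cont_scaled[OF this] have 4: "continuous_on {\<epsilon>\<^sup>2 * ?b..\<epsilon>\<^sup>2} \<phi>" by simp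
  have "\<epsilon>\<^sup>2 * ?b \<le> \<epsilon>\<^sup>2 * 1" using b eps2 by (intro mult_left_mono) linarith+
  then have "{\<epsilon>\<^sup>2 * ?b..\<epsilon>\<^sup>2} \<union> {\<epsilon>\<^sup>2..1} = {\<epsilon>\<^sup>2 * ?b..1}" using eps2(3) by auto
  then show ?case
    using continuous_on_closed_Un[OF _ _ 4 cont_top] by simp
qed

text \<open>Each factor \<open>\<epsilon>\<^sup>2\<close> in the argument applies the monotone
  \<open>lift\<close> once, both to the bound and to the value.\<close>

lemma lower_le_phi: "x \<in> {0..(\<epsilon>\<^sup>2) ^ n * u} \<Longrightarrow> lower n \<le> \<phi> x"
proof (induction n arbitrary: x)
  case 0
  then show ?case using phi_range[of x] order by (simp add: lower_def)
next
  case (Suc n)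
  define y where "y = x / \<epsilon>\<^sup>2"
  have x: "x = \<epsilon>\<^sup>2 * y" using eps2 by (simp add: y_def)
  have y: "y \<in> {0..(\<epsilon>\<^sup>2) ^ n * u}" using Suc.prems eps2 by (auto simp: x mult.assoc zero_le_mult_iff)
  have "(\<epsilon>\<^sup>2) ^ n * u \<le> u" using eps2 order by (simp add: mult_le_cancel_right2 power_le_one)
  with y have yu: "y \<in> {0..u}" by auto
  then have "\<phi> y \<in> {0..1}" using phi_range order by auto
  then show ?case
    using phi_scaled_low[OF yu] lift_mono[OF lower_mem _ Suc.IH[OF y]] by (simp add: x lower_Suc)
qed

lemma cont_phi: "continuous_on {0..1} \<phi>"
  unfolding continuous_on_eq_continuous_within
proof
  fix x :: real assume x: "x \<in> {0..1}"
  show "continuous (at x within {0..1}) \<phi>"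
  proof (cases "x = 0")
    case True
    \<comment> \<open>Values never exceed 1, so only the estimate from below needs work, and
      \<open>lower\<close> supplies it.\<close>
    have "(\<phi> \<longlongrightarrow> 1) (at 0 within {0..1})"
    proof (rule order_tendstoI)
      fix y :: real assume "1 < y"
      then have "\<phi> x < y" if "x \<in> {0..1}" for x using phi_range[OF that] by simp
      then show "\<forall>\<^sub>F x in at 0 within {0..1}. \<phi> x < y"
        by (auto simp: eventually_at_filter)
    next
      fix y :: real assume "y < 1"
      then have "\<forall>\<^sub>F n in sequentially. y < lower n"
        using lower_tendsto by (simp add: order_tendsto_iff)
      then obtain n where n: "y < lower n" by (auto simp: eventually_sequentially)
      have pos: "0 < (\<epsilon>\<^sup>2) ^ n * u" using eps2 order by simp
      show "\<forall>\<^sub>F x in at 0 within {0..1}. y < \<phi> x"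
        unfolding eventually_at
        by (rule exI[of _ "(\<epsilon>\<^sup>2) ^ n * u"])
          (use pos in \<open>auto simp: dist_real_def intro!: less_le_trans[OF n lower_le_phi]\<close>)
    qed
    then show ?thesis using True by (simp add: continuous_within phi_0)
  next
    case False
    then obtain n where n: "(\<epsilon>\<^sup>2) ^ n < x" using eps2_power_less[of x] x by auto
    have "(\<epsilon>\<^sup>2) ^ Suc n \<le> (\<epsilon>\<^sup>2) ^ n"
      using eps2 by (intro power_decreasing) auto
    with n have n: "(\<epsilon>\<^sup>2) ^ Suc n < x" by linarith
    have "continuous (at x within {(\<epsilon>\<^sup>2) ^ Suc n..1}) \<phi>"
      using cont_away_from_0[of n] n x by (auto simp: continuous_on_eq_continuous_within)
    \<comment> \<open>Since \<open>x\<close> exceeds the left end point, the two intervals agree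
      near \<open>x\<close>.\<close>
    moreover have "at x within {(\<epsilon>\<^sup>2) ^ Suc n..1} = at x within {0..1}"
    proof (rule at_within_nhd)
      show "x \<in> {(\<epsilon>\<^sup>2) ^ Suc n<..}" using n by simp
      have "0 < (\<epsilon>\<^sup>2) ^ Suc n" using eps2 by simp
      then show "{(\<epsilon>\<^sup>2) ^ Suc n..1} \<inter> {(\<epsilon>\<^sup>2) ^ Suc n<..} - {x} = {0..1} \<inter> {(\<epsilon>\<^sup>2) ^ Suc n<..} - {x}"
        by (auto simp del: power_Suc)
    qed simp
    ultimately show ?thesis by (simp add: continuous_within)
  qed
qed

lemma svep: "svep_solution \<epsilon> \<phi>"
proof -
  have "strict_antimono_on {\<epsilon>\<^sup>2..u} \<phi>"
    using strict_monos(1) phi_top(1) by (simp add: monotone_on_def)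
  moreover have "strict_mono_on {v..1} \<phi>"
    using strict_monos(2) phi_top(3) by (simp add: monotone_on_def)
  moreover have "\<forall>x\<in>{u..v}. \<forall>y\<in>{u..v}. \<phi> x = \<phi> y" using phi_top(2) by simp
  ultimately have "single_valley_platform (\<epsilon>\<^sup>2) 1 \<phi>"
    unfolding single_valley_platform_def using order by (meson less_imp_le)
  then show ?thesis
    using phi_range phi_equation phi_0 cont_phi by (auto simp: svep_solution_def fks2_solution_def)
qed

end

section \<open>Existence of the pieces and of a glued function\<close>

context platform_data
begin

text \<open>At a shared end point the tests pick one of two formulas. Agreement with the other is
  proved in \<open>pieces_built\<close> within a level and in \<open>built_meet\<close> between
  levels.\<close>

fun built :: "nat \<Rightarrow> real \<Rightarrow> real" where
  "built 0 x = (if x \<le> u then q x else if x \<le> v then 0 else p x)"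
| "built (Suc 0) x =
     (if x \<le> \<epsilon>\<^sup>2 * u then pinv (\<epsilon> * q (x / \<epsilon>\<^sup>2))
      else if x \<le> \<epsilon>\<^sup>2 * v then h x else qinv (\<epsilon> * p (x / \<epsilon>\<^sup>2)))"
| "built (Suc (Suc k)) x = pinv (\<epsilon> * built (Suc k) (x / \<epsilon>\<^sup>2))"

lemma pieces_built: "pieces \<epsilon> u v q p h built"
proof -
  have "eq_phi0 \<epsilon> u v q p (built 0)"
    using order end_values by (auto simp: eq_phi0_def)
  moreover have "eq_A \<epsilon> u v q p h (built 1)"
  proof -
    have uv: "\<epsilon>\<^sup>2 * u < \<epsilon>\<^sup>2 * v" using eps2 order by simp
    \<comment> \<open>The prescribed end values of \<open>h\<close> are exactly
      \<open>pinv 0 = v\<close> and \<open>qinv 0 = u\<close>.\<close>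
    have "built 1 (\<epsilon>\<^sup>2 * u) = h (\<epsilon>\<^sup>2 * u)" "built 1 (\<epsilon>\<^sup>2 * v) = qinv (\<epsilon> * p (\<epsilon>\<^sup>2 * v / \<epsilon>\<^sup>2))"
      using uv end_values qinv_values pinv_values eps_pos by simp_all
    then have "built 1 x = h x" if "x \<in> {\<epsilon>\<^sup>2 * u..\<epsilon>\<^sup>2 * v}" for x
      using that by (cases "x = \<epsilon>\<^sup>2 * u") simp_all
    moreover have "built 1 x = qinv (\<epsilon> * p (x / \<epsilon>\<^sup>2))" if "x \<in> {\<epsilon>\<^sup>2 * v..\<epsilon>\<^sup>2}" for x
      using that uv \<open>built 1 (\<epsilon>\<^sup>2 * v) = _\<close> by (cases "x = \<epsilon>\<^sup>2 * v") simp_all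
    ultimately show ?thesis by (simp add: eq_A_def)
  qed
  moreover have "eq_B \<epsilon> v p built"
    unfolding eq_B_def
  proof (intro allI impI)
    fix k :: nat assume "2 \<le> k"
    then obtain j where "k = Suc (Suc j)" by (metis add_2_eq_Suc le_Suc_ex)
    then show "\<forall>x\<in>level \<epsilon> k. built k x = pinv (\<epsilon> * built (k - 1) (x / \<epsilon>\<^sup>2))" by simp
  qed
  ultimately show ?thesis by (simp add: pieces_def)
qed

text \<open>At \<open>\<epsilon>\<^sup>2\<close> both values are \<open>a\<close>: this is where
  \<open>q a = \<epsilon>\<^sup>2\<close> enters, through
  \<open>qinv (\<epsilon> * p 1) = a\<close>. Each later agreement is the image of the previous one
  under the same formula.\<close>

lemma built_meet: "built k ((\<epsilon>\<^sup>2) ^ Suc k) = built (Suc k) ((\<epsilon>\<^sup>2) ^ Suc k)"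
proof (induction k)
  case 0
  have "\<epsilon>\<^sup>2 * v < \<epsilon>\<^sup>2" "\<epsilon>\<^sup>2 * u < \<epsilon>\<^sup>2" using eps2 order by simp_all
  then show ?case using order end_values qinv_values eps_pos by (simp add: power2_eq_square)
next
  case (Suc k)
  show ?case
  proof (cases k)
    case 0
    \<comment> \<open>The first level has its own formula in \<open>q\<close> rather than the
      recursive clause; both sides become \<open>pinv (\<epsilon> * a)\<close>.\<close>
    have "\<epsilon>\<^sup>2 * \<epsilon>\<^sup>2 \<le> \<epsilon>\<^sup>2 * u" using eps2 order by (intro mult_left_mono) simp_all
    moreover have "built (Suc 0) (\<epsilon>\<^sup>2) = a"
      using Suc 0 order end_values by simp
    moreover have "\<epsilon>\<^sup>2 * \<epsilon>\<^sup>2 / \<epsilon>\<^sup>2 = \<epsilon>\<^sup>2" using eps_pos by (intro nonzero_mult_div_cancel_left) simp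
    ultimately have "built (Suc 0) (\<epsilon>\<^sup>2 * \<epsilon>\<^sup>2) = pinv (\<epsilon> * a)"
      using end_values by (simp only: built.simps if_True)
    then show ?thesis
      using 0 \<open>built (Suc 0) (\<epsilon>\<^sup>2) = a\<close> \<open>\<epsilon>\<^sup>2 * \<epsilon>\<^sup>2 / \<epsilon>\<^sup>2 = \<epsilon>\<^sup>2\<close>
      by (simp only: built.simps(3) power_Suc power_0 mult_1_right)
  next
    case (Suc j)
    have "(\<epsilon>\<^sup>2) ^ Suc n / \<epsilon>\<^sup>2 = (\<epsilon>\<^sup>2) ^ n" for n using eps_pos by simp
    then have step: "built (Suc (Suc i)) ((\<epsilon>\<^sup>2) ^ Suc n) = pinv (\<epsilon> * built (Suc i) ((\<epsilon>\<^sup>2) ^ n))" for i n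
      by (simp only: built.simps(3))
    show ?thesis
      using Suc.IH by (simp only: Suc step[of j "Suc (Suc j)"] step[of "Suc j" "Suc (Suc j)"])
  qed
qed

text \<open>A point may belong to two levels; \<open>built_meet\<close> makes the choice by
  \<open>SOME\<close> immaterial. The point 0 is in no level.\<close>

lemma glued_exists: "\<exists>\<phi>. glues \<epsilon> built \<phi>"
proof
  let ?\<phi> = "\<lambda>x. if x = 0 then 1 else built (SOME k. x \<in> level \<epsilon> k) x"
  have meet: "built j x = built k x" if "x \<in> level \<epsilon> j" "x \<in> level \<epsilon> k" "j < k" for j k x
    using levels_meet[OF that] built_meet[of j] by simp
  have "?\<phi> x = built k x" if "x \<in> level \<epsilon> k" for x k
  proof -
    have "x \<in> level \<epsilon> (SOME k. x \<in> level \<epsilon> k)" using that by (rule someI)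
    then have "built (SOME k. x \<in> level \<epsilon> k) x = built k x"
      using meet that by (metis linorder_neqE_nat)
    then show ?thesis using mem_level_le[OF that] by simp
  qed
  then show "glues \<epsilon> built ?\<phi>" by (simp add: glues_def)
qed

end

section \<open>Converse: the structure of a given solution\<close>

locale platform_solution = contraction_ratio +
  fixes f :: "real \<Rightarrow> real" and u v :: real
  assumes svep: "svep_solution \<epsilon> f"
    and min_points: "minimum_points f = {u..v}"
    and f_eps2: "\<epsilon>\<^sup>2 \<le> f (\<epsilon>\<^sup>2)" "f (\<epsilon>\<^sup>2) < u"
begin

lemma f_range: "x \<in> {0..1} \<Longrightarrow> f x \<in> {0..1}"
  using svep by (auto simp: svep_solution_def fks2_solution_def)

lemma f_eq: "x \<in> {0..1} \<Longrightarrow> f (f (\<epsilon>\<^sup>2 * x)) = \<epsilon> * f x"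
  using svep by (auto simp: svep_solution_def fks2_solution_def)

lemma f_0: "f 0 = 1"
  using svep by (auto simp: svep_solution_def fks2_solution_def)

lemma f_1: "f 1 = \<epsilon>"
  using f_eq[of 0] f_0 by simp

lemma f_cont: "continuous_on {0..1} f"
  using svep by (auto simp: svep_solution_def)

lemma scaled_mem: "x \<in> {0..1} \<Longrightarrow> \<epsilon>\<^sup>2 * x \<in> {0..1}"
  using eps2 by (auto intro: mult_le_one)

text \<open>If the minimum is attained at \<open>m\<close>, the equation produces a point with value
  \<open>\<epsilon> * f m\<close>. The minimum is thus at most \<epsilon> times itself, hence
  0.\<close>

lemma zeros: "x \<in> {u..v} \<longleftrightarrow> x \<in> {0..1} \<and> f x = 0"
proof -
  obtain m where m: "m \<in> {0..1}" "\<And>y. y \<in> {0..1} \<Longrightarrow> f m \<le> f y"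
    using continuous_attains_inf[OF compact_Icc _ f_cont] by auto
  have "f m \<le> \<epsilon> * f m"
    using m(2)[OF f_range[OF scaled_mem[OF m(1)]]] f_eq[OF m(1)] by simp
  then have "(1 - \<epsilon>) * f m \<le> 0" by (simp add: algebra_simps)
  then have "f m \<le> 0" using eps_less_1 by (simp add: mult_le_0_iff)
  then have "f m = 0" using f_range[OF m(1)] by simp
  then have "x \<in> minimum_points f \<longleftrightarrow> x \<in> {0..1} \<and> f x = 0"
    using m f_range by (force simp: minimum_points_def)
  then show ?thesis by (simp add: min_points)
qed

text \<open>The valley condition supplies its own end points \<open>u'\<close> and
  \<open>v'\<close>. They coincide with those of the minimum set, as
  \<open>\<epsilon>\<^sup>2 < u\<close> keeps all zeros within the domain of the valley.\<close>

lemma valley: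
  shows "u < v" "v < 1" "strict_antimono_on {\<epsilon>\<^sup>2..u} f" "strict_mono_on {v..1} f"
proof -
  have "minimum_points f \<noteq> {}"
    using continuous_attains_inf[OF compact_Icc _ f_cont] by (auto simp: minimum_points_def)
  then have uv: "u \<le> v" using min_points by auto
  then have zu: "u \<in> {0..1}" "f u = 0" "v \<in> {0..1}" "f v = 0" using zeros[of u] zeros[of v] by auto
  have eu: "\<epsilon>\<^sup>2 < u" using f_eps2 by simp
  obtain u' v' where *: "\<epsilon>\<^sup>2 \<le> u'" "u' < v'" "v' \<le> 1"
    "strict_antimono_on {\<epsilon>\<^sup>2..u'} f" "\<forall>x\<in>{u'..v'}. \<forall>y\<in>{u'..v'}. f x = f y" "strict_mono_on {v'..1} f"
    using svep by (auto simp: svep_solution_def single_valley_platform_def)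
  have pos: "0 \<le> f x" if "x \<in> {\<epsilon>\<^sup>2..1}" for x using f_range[of x] that eps2(1) unfolding atLeastAtMost_iff by linarith
  have left: "f u' < f x" if "x \<in> {\<epsilon>\<^sup>2..<u'}" for x
    using that *(1,4) by (auto simp: monotone_on_def)
  have right: "f v' < f x" if "x \<in> {v'<..1}" for x
    using that *(3,6) by (auto simp: monotone_on_def)
  have "f u' = f v'" using *(2,5) by auto
  have "0 \<le> f u'" "0 \<le> f v'" using pos * by auto
  \<comment> \<open>Off the platform, strict monotonicity puts \<open>f\<close> above a nonnegative
    value, so no zero occurs there.\<close>
  have inside: "x \<in> {u'..v'}" if "x \<in> {u..v}" for x
  proof (rule ccontr)
    assume "x \<notin> {u'..v'}"
    moreover have "x \<in> {\<epsilon>\<^sup>2..1}" using that eu zu by auto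
    ultimately have "f x \<noteq> 0"
      using left[of x] right[of x] \<open>0 \<le> f u'\<close> \<open>0 \<le> f v'\<close> by fastforce
    then show False using zeros that by blast
  qed
  then have "f u' = 0" using *(2,5) zu uv by (metis atLeastAtMost_iff order_refl less_imp_le)
  have "u' \<in> {u..v}" "v' \<in> {u..v}"
    using \<open>f u' = 0\<close> \<open>f u' = f v'\<close> zeros[of u'] zeros[of v'] *(1-3) eps2(1)
    unfolding atLeastAtMost_iff by linarith+
  with inside[of u] inside[of v] uv have "u' = u" "v' = v" by auto
  then show "u < v" "strict_antimono_on {\<epsilon>\<^sup>2..u} f" "strict_mono_on {v..1} f" using * by auto
  have "v \<noteq> 1" using zu f_1 eps_pos by auto
  then show "v < 1" using zu by simp
qed

lemma bounds: "\<epsilon>\<^sup>2 < u" "0 < u" "0 < v" "f u = 0" "f v = 0" "f (f (\<epsilon>\<^sup>2)) = \<epsilon>\<^sup>2"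
  using f_eps2 eps2 valley zeros[of u] zeros[of v] f_eq[of 1] f_1 by (auto simp: power2_eq_square)

text \<open>Both memberships say that \<open>f\<close> vanishes, and the equation makes the two
  values proportional.\<close>

lemma scaled_mem_platform_iff:
  assumes "x \<in> {0..1}"
  shows "f (\<epsilon>\<^sup>2 * x) \<in> {u..v} \<longleftrightarrow> x \<in> {u..v}"
  using zeros[of x] zeros[of "f (\<epsilon>\<^sup>2 * x)"] f_range[OF scaled_mem[OF assms]] f_eq[OF assms] assms eps_pos
  by auto

text \<open>The scaled function starts at 1, so to drop below \<open>v\<close> it must take the
  value \<open>v\<close> at some \<open>y \<le> x\<close>. Then \<open>y\<close> is in
  \<open>{u..v}\<close>, which forces \<open>y = x\<close>.\<close>

lemma f_low:
  assumes "x \<in> {0..u}"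
  shows "f (\<epsilon>\<^sup>2 * x) \<in> {v..1}"
proof (rule ccontr)
  assume "\<not> ?thesis"
  moreover have "\<epsilon>\<^sup>2 * x \<in> {0..1}" using scaled_mem assms valley by auto
  ultimately have lt: "f (\<epsilon>\<^sup>2 * x) < v" using f_range by fastforce
  have "continuous_on {0..x} (\<lambda>y. f (\<epsilon>\<^sup>2 * y))"
    by (rule continuous_on_compose2[OF f_cont])
      (use assms valley scaled_mem in \<open>auto intro!: continuous_intros simp: image_subset_iff\<close>)
  then obtain y where y: "0 \<le> y" "y \<le> x" "f (\<epsilon>\<^sup>2 * y) = v"
    using IVT2'[of "\<lambda>y. f (\<epsilon>\<^sup>2 * y)" x v 0] lt assms valley f_0 by auto
  then have "y \<in> {u..v}" using scaled_mem_platform_iff[of y] assms valley by auto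
  then have "y = x" using y assms by auto
  then show False using y lt by simp
qed

text \<open>The value is at least \<open>v\<close> by \<open>f_low\<close> and at most
  \<open>v\<close> because \<open>u\<close> is on the platform.\<close>

lemma f_scaled_u: "f (\<epsilon>\<^sup>2 * u) = v"
  using f_low[of u] scaled_mem_platform_iff[of u] bounds valley by auto

lemma f_mid: "x \<in> {u..v} \<Longrightarrow> f (\<epsilon>\<^sup>2 * x) \<in> {u..v}"
  using scaled_mem_platform_iff zeros by blast

text \<open>Mirror image of \<open>f_low\<close>, using the end value
  \<open>f (\<epsilon>\<^sup>2) < u\<close> at the point 1.\<close>

lemma f_high_le:
  assumes "x \<in> {v..1}"
  shows "f (\<epsilon>\<^sup>2 * x) \<le> u"
proof (rule ccontr)
  assume gt: "\<not> ?thesis"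
  have "continuous_on {x..1} (\<lambda>y. f (\<epsilon>\<^sup>2 * y))"
    by (rule continuous_on_compose2[OF f_cont])
      (use assms bounds scaled_mem in \<open>auto intro!: continuous_intros simp: image_subset_iff\<close>)
  then obtain y where y: "x \<le> y" "y \<le> 1" "f (\<epsilon>\<^sup>2 * y) = u"
    using IVT2'[of "\<lambda>y. f (\<epsilon>\<^sup>2 * y)" 1 u x] gt assms valley f_eps2 by auto
  then have "y \<in> {u..v}" using scaled_mem_platform_iff[of y] assms valley bounds by auto
  then have "y = x" using y assms by auto
  then show False using y gt by simp
qed

lemma f_scaled_v: "f (\<epsilon>\<^sup>2 * v) = u"
  using f_high_le[of v] scaled_mem_platform_iff[of v] bounds valley by auto

text \<open>On \<open>[v, 1]\<close> the map \<open>x \<mapsto> f (\<epsilon>\<^sup>2 x)\<close> is injective because \<open>f\<close> composed with it is \<open>\<epsilon> f\<close>;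
  being continuous, it is monotone, hence stays between its end values \<open>u\<close> and \<open>f (\<epsilon>\<^sup>2)\<close>.\<close>

lemma f_high:
  assumes "x \<in> {v..1}"
  shows "f (\<epsilon>\<^sup>2 * x) \<in> {\<epsilon>\<^sup>2..u}"
proof -
  have cont: "continuous_on {v..1} (\<lambda>y. f (\<epsilon>\<^sup>2 * y))"
    by (rule continuous_on_compose2[OF f_cont])
      (use bounds scaled_mem in \<open>auto intro!: continuous_intros simp: image_subset_iff\<close>)
  have "inj_on f {v..1}" using valley(4) by (rule strict_mono_on_imp_inj_on)
  have inj: "inj_on (\<lambda>y. f (\<epsilon>\<^sup>2 * y)) {v..1}"
  proof (rule inj_onI, goal_cases)
    case (1 x y)
    then have "x \<in> {0..1}" "y \<in> {0..1}" using bounds by auto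
    then have "\<epsilon> * f x = \<epsilon> * f y" using f_eq[of x] f_eq[of y] 1(3) by metis
    then have "f x = f y" using eps_pos by simp
    then show ?case using inj_onD[OF \<open>inj_on f {v..1}\<close>] 1 by blast
  qed
  consider "x = v" | "x = 1" | "v < x" "x < 1" using assms by fastforce
  then have "\<epsilon>\<^sup>2 \<le> f (\<epsilon>\<^sup>2 * x)"
  proof cases
    case 3
    then show ?thesis
      using continuous_inj_imp_mono[OF 3 cont inj] f_scaled_v f_eps2 by auto
  qed (use f_scaled_v f_eps2 in auto)
  with f_high_le[OF assms] show ?thesis by simp
qed

text \<open>A solution \<open>x < 1\<close> of \<open>f x = \<epsilon> x\<close> in \<open>[v, 1]\<close> would bound \<open>f (\<epsilon>\<^bsup>2n\<^esup> u)\<close> by \<open>x\<close> for all \<open>n\<close>,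
  although these values converge to \<open>f 0 = 1\<close>.\<close>

lemma f_cond_ii: "cond_ii \<epsilon> v f"
  unfolding cond_ii_def
proof (intro ballI iffI)
  fix x assume x: "x \<in> {v..1}" and eq: "f x = \<epsilon> * x"
  have mem: "(\<epsilon>\<^sup>2) ^ n * u \<in> {0..u}" for n
    using eps2 bounds by (simp add: mult_le_cancel_right2 power_le_one)
  have le: "f ((\<epsilon>\<^sup>2) ^ n * u) \<le> x" for n
  proof (induction n)
    case 0
    show ?case using bounds x by simp
  next
    case (Suc n)
    let ?y = "(\<epsilon>\<^sup>2) ^ n * u"
    have y: "f (\<epsilon>\<^sup>2 * ?y) \<in> {v..1}" using f_low mem by blast
    have y1: "?y \<in> {0..1}" using mem[of n] valley by auto
    \<comment> \<open>Both sides are \<epsilon> times the two sides of the induction hypothesis; the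
      increasing branch then reflects the order.\<close>
    have "f (f (\<epsilon>\<^sup>2 * ?y)) \<le> f x"
      using f_eq[OF y1] eq Suc eps_pos by simp
    then have "f (\<epsilon>\<^sup>2 * ?y) \<le> x"
      using strict_mono_onD[OF valley(4) x y] by fastforce
    then show ?case by (simp add: mult.assoc)
  qed
  have "(\<lambda>n. (\<epsilon>\<^sup>2) ^ n * u) \<longlonglongrightarrow> 0 * u"
    using eps2 by (intro tendsto_mult LIMSEQ_power_zero) auto
  then have lim: "(\<lambda>n. (\<epsilon>\<^sup>2) ^ n * u) \<longlonglongrightarrow> 0" by simp
  have "(\<epsilon>\<^sup>2) ^ n * u \<in> {0..1}" for n using mem[of n] valley by auto
  then have "(\<lambda>n. f ((\<epsilon>\<^sup>2) ^ n * u)) \<longlonglongrightarrow> f 0"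
    using continuous_on_tendsto_compose[OF f_cont lim] by simp
  then have "f 0 \<le> x" by (rule LIMSEQ_le_const2) (use le in blast)
  then show "x = 1" using f_0 x by simp
qed (use f_1 in simp)

text \<open>The codomains come from the extreme values of the monotone branches and from
  \<open>f_mid\<close>; restriction changes no value on the pieces.\<close>

lemma admissible_restrict:
  "admissible_data \<epsilon> u v (f (\<epsilon>\<^sup>2)) (restrict f {\<epsilon>\<^sup>2..u}) (restrict f {v..1})
     (restrict f {\<epsilon>\<^sup>2 * u..\<epsilon>\<^sup>2 * v})"
proof -
  have q: "f x \<in> {0..f (\<epsilon>\<^sup>2)}" if "x \<in> {\<epsilon>\<^sup>2..u}" for x
  proof -
    have "f x \<le> f (\<epsilon>\<^sup>2)"
      using that valley(3) by (cases "x = \<epsilon>\<^sup>2") (auto simp: monotone_on_def intro: less_imp_le)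
    then show ?thesis using f_range[of x] that valley(1,2) eps2(1) unfolding atLeastAtMost_iff by linarith
  qed
  have p: "f x \<in> {0..\<epsilon>}" if "x \<in> {v..1}" for x
  proof -
    have "f x \<le> f 1"
      using that valley(2,4) by (cases "x = 1") (auto simp: monotone_on_def intro: less_imp_le)
    then show ?thesis using f_range[of x] that bounds f_1 by auto
  qed
  have h: "f x \<in> {u..v}" if "x \<in> {\<epsilon>\<^sup>2 * u..\<epsilon>\<^sup>2 * v}" for x
    using f_mid[of "x / \<epsilon>\<^sup>2"] that eps_pos by (simp add: field_simps)
  have "\<epsilon>\<^sup>2 * v \<le> 1" "0 \<le> \<epsilon>\<^sup>2 * u" "\<epsilon>\<^sup>2 * u \<le> \<epsilon>\<^sup>2 * v" using eps2 bounds valley by (simp_all add: mult_le_one)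
  then have sub: "{\<epsilon>\<^sup>2..u} \<subseteq> {0..1}" "{v..1} \<subseteq> {0..1}" "{\<epsilon>\<^sup>2 * u..\<epsilon>\<^sup>2 * v} \<subseteq> {0..1}"
    using bounds valley by auto
  have cont: "continuous_on A (restrict f A)" if "A \<subseteq> {0..1}" for A
    using continuous_on_subset[OF f_cont that] continuous_on_cong[of A A "restrict f A" f] by simp
  have "strict_antimono_on {\<epsilon>\<^sup>2..u} (restrict f {\<epsilon>\<^sup>2..u})" "strict_mono_on {v..1} (restrict f {v..1})"
    using valley by (simp_all add: monotone_on_def)
  moreover have "cond_ii \<epsilon> v (restrict f {v..1})"
    using f_cond_ii by (simp add: cond_ii_def)
  moreover have "cond_i \<epsilon> u v (f (\<epsilon>\<^sup>2)) (restrict f {\<epsilon>\<^sup>2..u}) (restrict f {v..1})"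
    using bounds f_1 valley f_eps2 by (simp add: cond_i_def)
  ultimately show ?thesis
    unfolding admissible_data_def
    using f_eps2 valley(1,2) cont[OF sub(1)] cont[OF sub(2)] cont[OF sub(3)] q p h f_scaled_u f_scaled_v eps2
    by (intro conjI) simp_all
qed

text \<open>Since \<open>f (\<epsilon>\<^sup>2 * x)\<close> lies in a known branch and
  \<open>f\<close> sends it to \<open>\<epsilon> * f x\<close>, injectivity of that branch
  identifies it as the inverse image.\<close>

lemma pieces_restrict:
  "pieces \<epsilon> u v (restrict f {\<epsilon>\<^sup>2..u}) (restrict f {v..1}) (restrict f {\<epsilon>\<^sup>2 * u..\<epsilon>\<^sup>2 * v})
     (\<lambda>k. restrict f (level \<epsilon> k))"
proof -
  let ?q = "restrict f {\<epsilon>\<^sup>2..u}" and ?p = "restrict f {v..1}"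
  \<comment> \<open>The restrictions are admissible, so injectivity of the branches is inherited
    from the construction.\<close>
  have data: "platform_data \<epsilon> u v (f (\<epsilon>\<^sup>2)) ?q ?p (restrict f {\<epsilon>\<^sup>2 * u..\<epsilon>\<^sup>2 * v})"
    by unfold_locales (rule admissible_restrict)
  have q: "f (\<epsilon>\<^sup>2 * x) = inv_into {\<epsilon>\<^sup>2..u} ?q (\<epsilon> * f x)" if "x \<in> {v..1}" for x
  proof -
    have "?q (f (\<epsilon>\<^sup>2 * x)) = \<epsilon> * f x" using f_high[OF that] f_eq[of x] that bounds by simp
    then show ?thesis
      using inv_into_f_f[OF platform_data.inj_q[OF data] f_high[OF that]] by simp
  qed
  have p: "f (\<epsilon>\<^sup>2 * x) = inv_into {v..1} ?p (\<epsilon> * f x)" if "x \<in> {0..u}" for x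
  proof -
    have "?p (f (\<epsilon>\<^sup>2 * x)) = \<epsilon> * f x" using f_low[OF that] f_eq[of x] that valley by simp
    then show ?thesis
      using inv_into_f_f[OF platform_data.inj_p[OF data] f_low[OF that]] by simp
  qed
  have e4: "\<epsilon> ^ 4 = \<epsilon>\<^sup>2 * \<epsilon>\<^sup>2" by (simp add: power_add[symmetric])
  have e: "\<epsilon>\<^sup>2 * \<epsilon>\<^sup>2 < \<epsilon>\<^sup>2 * u" "\<epsilon>\<^sup>2 * u < \<epsilon>\<^sup>2 * v" "\<epsilon>\<^sup>2 * v < \<epsilon>\<^sup>2"
    using mult_strict_left_mono[OF _ eps2(1)] bounds(1) valley(1,2) by (blast, blast, force)
  have l1: "level \<epsilon> 1 = {\<epsilon>\<^sup>2 * \<epsilon>\<^sup>2..\<epsilon>\<^sup>2}" "level \<epsilon> 0 = {\<epsilon>\<^sup>2..1}" by (simp_all add: level_eq_power)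
  have "eq_phi0 \<epsilon> u v ?q ?p (restrict f (level \<epsilon> 0))"
    unfolding eq_phi0_def l1 using bounds valley zeros by auto
  moreover have "eq_A \<epsilon> u v ?q ?p (restrict f {\<epsilon>\<^sup>2 * u..\<epsilon>\<^sup>2 * v}) (restrict f (level \<epsilon> 1))"
    unfolding eq_A_def l1 e4
  proof (intro conjI ballI)
    fix x assume x: "x \<in> {\<epsilon>\<^sup>2 * v..\<epsilon>\<^sup>2}"
    then have "x / \<epsilon>\<^sup>2 \<in> {v..1}" using eps_pos by (simp add: field_simps)
    moreover have m: "x \<in> {\<epsilon>\<^sup>2 * \<epsilon>\<^sup>2..\<epsilon>\<^sup>2}" using x e by simp
    ultimately show "restrict f {\<epsilon>\<^sup>2 * \<epsilon>\<^sup>2..\<epsilon>\<^sup>2} x = inv_into {\<epsilon>\<^sup>2..u} ?q (\<epsilon> * ?p (x / \<epsilon>\<^sup>2))"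
      using q[of "x / \<epsilon>\<^sup>2"] x m eps_pos by simp
  next
    fix x assume x: "x \<in> {\<epsilon>\<^sup>2 * u..\<epsilon>\<^sup>2 * v}"
    then show "restrict f {\<epsilon>\<^sup>2 * \<epsilon>\<^sup>2..\<epsilon>\<^sup>2} x = restrict f {\<epsilon>\<^sup>2 * u..\<epsilon>\<^sup>2 * v} x"
      using e by simp
  next
    fix x assume x: "x \<in> {\<epsilon>\<^sup>2 * \<epsilon>\<^sup>2..\<epsilon>\<^sup>2 * u}"
    then have m: "x / \<epsilon>\<^sup>2 \<in> {\<epsilon>\<^sup>2..u}" using eps_pos by (simp add: field_simps)
    have x': "x \<in> {\<epsilon>\<^sup>2 * \<epsilon>\<^sup>2..\<epsilon>\<^sup>2}" using x e by simp
    have "x / \<epsilon>\<^sup>2 \<in> {0..u}" using m eps2(1) unfolding atLeastAtMost_iff by linarith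
    then show "restrict f {\<epsilon>\<^sup>2 * \<epsilon>\<^sup>2..\<epsilon>\<^sup>2} x = inv_into {v..1} ?p (\<epsilon> * ?q (x / \<epsilon>\<^sup>2))"
      using p[of "x / \<epsilon>\<^sup>2"] m x' eps_pos by simp
  qed
  moreover have "eq_B \<epsilon> v ?p (\<lambda>k. restrict f (level \<epsilon> k))"
    unfolding eq_B_def
  proof (intro allI impI ballI)
    fix k :: nat and x assume "2 \<le> k" and x: "x \<in> level \<epsilon> k"
    then obtain j where j: "k = Suc (Suc j)" by (metis add_2_eq_Suc le_Suc_ex)
    with x obtain y where y: "y \<in> level \<epsilon> (Suc j)" "x = \<epsilon>\<^sup>2 * y" by (auto elim: mem_level_SucE)
    \<comment> \<open>From \<open>k \<ge> 2\<close>, the point \<open>y\<close> is at level 1 or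
      later, hence at most \<open>\<epsilon>\<^sup>2 < u\<close>: only the \<open>p\<close> branch
      occurs in \<open>eq_B\<close>.\<close>
    then have "y \<in> {0..u}" using mem_level_le[of y] mem_level_Suc_le[of y] bounds by force
    then show "restrict f (level \<epsilon> k) x
        = inv_into {v..1} ?p (\<epsilon> * restrict f (level \<epsilon> (k - 1)) (x / \<epsilon>\<^sup>2))"
      using p[of y] x y j eps_pos by simp
  qed
  ultimately show ?thesis by (simp add: pieces_def)
qed

end

theorem theorem4p1:
  fixes \<epsilon> :: real
  assumes "0 < \<epsilon>" and "\<epsilon> < 1"
  shows
    "(\<forall>u v a q p h. admissible_data \<epsilon> u v a q p h \<longrightarrow>
        (\<exists>\<Phi> \<phi>. pieces \<epsilon> u v q p h \<Phi> \<and> glues \<epsilon> \<Phi> \<phi>) \<and>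
        (\<forall>\<Phi> \<phi>. pieces \<epsilon> u v q p h \<Phi> \<and> glues \<epsilon> \<Phi> \<phi> \<longrightarrow> svep_solution \<epsilon> \<phi>)) \<and>
     (\<forall>f u v \<Phi> a q p h.
        svep_solution \<epsilon> f \<and> minimum_points f = {u..v} \<and>
        \<epsilon>\<^sup>2 \<le> f (\<epsilon>\<^sup>2) \<and> f (\<epsilon>\<^sup>2) < u \<and>
        (\<forall>k. \<Phi> k = restrict f (level \<epsilon> k)) \<and> a = f (\<epsilon>\<^sup>2) \<and>
        q = restrict f {\<epsilon>\<^sup>2..u} \<and> p = restrict f {v..1} \<and>
        h = restrict f {\<epsilon>\<^sup>2 * u..\<epsilon>\<^sup>2 * v} \<longrightarrow>
        admissible_data \<epsilon> u v a q p h \<and> pieces \<epsilon> u v q p h \<Phi>)"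
proof (intro conjI allI impI; (elim conjE)?)
  interpret contraction_ratio \<epsilon> using assms by unfold_locales
  fix u v a q p h
  assume adm: "admissible_data \<epsilon> u v a q p h"
  interpret platform_data \<epsilon> u v a q p h by unfold_locales (rule adm)
  show "\<exists>\<Phi> \<phi>. pieces \<epsilon> u v q p h \<Phi> \<and> glues \<epsilon> \<Phi> \<phi>"
    using pieces_built glued_exists by blast
next
  fix u v a q p h \<Phi> \<phi>
  assume "admissible_data \<epsilon> u v a q p h" "pieces \<epsilon> u v q p h \<Phi>" "glues \<epsilon> \<Phi> \<phi>"
  then interpret platform_glued \<epsilon> u v a q p h \<Phi> \<phi> using assms by unfold_locales
  show "svep_solution \<epsilon> \<phi>" by (rule svep)
next
  fix f u v \<Phi> a q p h
  assume *: "svep_solution \<epsilon> f" "minimum_points f = {u..v}" "\<epsilon>\<^sup>2 \<le> f (\<epsilon>\<^sup>2)" "f (\<epsilon>\<^sup>2) < u"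
    and \<Phi>: "\<forall>k. \<Phi> k = restrict f (level \<epsilon> k)"
    and data: "a = f (\<epsilon>\<^sup>2)" "q = restrict f {\<epsilon>\<^sup>2..u}" "p = restrict f {v..1}"
      "h = restrict f {\<epsilon>\<^sup>2 * u..\<epsilon>\<^sup>2 * v}"
  from * interpret platform_solution \<epsilon> f u v using assms by unfold_locales
  show "admissible_data \<epsilon> u v a q p h" unfolding data by (rule admissible_restrict)
  have "\<Phi> = (\<lambda>k. restrict f (level \<epsilon> k))" using \<Phi> by auto
  then show "pieces \<epsilon> u v q p h \<Phi>" unfolding data using pieces_restrict by simp
qed

end
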